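(* Let $b\ge2$ and let $0\le j\le n$ be integers. Then $$\sum_{k=j}^{n}\binom{n}{k}_b\binom{k}{j}_b(-1)^{S_b(k)+S_b(j)}=\delta_{n,j},$$ where $\delta_{n,j}=1$ if $n=j$ and $0$ otherwise, $S_b(m)$ is the sum of the base-$b$ digits of $m$, and $\binom{n}{k}_b=\prod_{l}\binom{n_l}{k_l}$ is the product over digit positions of ordinary binomial coefficients of the base-$b$ digits $n_l,k_l$ of $n,k$ (with $\binom{a}{c}=0$ for $c>a$).
   Context: Base-$b$ digits of $m\ge0$: the unique $m_l\in\{0,\dots,b-1\}$ with $m=\sum_lm_lb^l$. *)

theory Defs
  imports Main "HOL-Library.Groups_Big_Fun"
begin

definition digit :: "nat \<Rightarrow> nat \<Rightarrow> nat \<Rightarrow> nat" where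
  "digit b m l = m div b ^ l mod b"

text \<open>Sums and products over all digit positions are \<^const>\<open>Sum_any\<close> and \<^const>\<open>Prod_any\<close>. These
  yield the neutral element when infinitely many terms are non-neutral, which by
  \<open>finite_digit_support\<close> and \<open>finite_bbinom_support\<close> does not happen for \<open>b \<ge> 2\<close>.\<close>

definition digit_sum :: "nat \<Rightarrow> nat \<Rightarrow> nat" where
  "digit_sum b m = Sum_any (\<lambda>l. digit b m l)"

definition bbinom :: "nat \<Rightarrow> nat \<Rightarrow> nat \<Rightarrow> nat" where
  "bbinom b n k = Prod_any (\<lambda>l. digit b n l choose digit b k l)"

lemma digit_eq_0:
  assumes "2 \<le> b" "m \<le> l"
  shows "digit b m l = 0"
proof -
  have "m \<le> l" by fact
  also have "l < 2 ^ l" by (rule less_exp)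
  also have "(2::nat) ^ l \<le> b ^ l" using assms(1) by (rule power_mono) simp
  finally show ?thesis by (simp add: digit_def)
qed

lemma finite_digit_support:
  assumes "2 \<le> b"
  shows "finite {l. digit b m l \<noteq> 0}"
proof (rule finite_subset)
  show "{l. digit b m l \<noteq> 0} \<subseteq> {..<m}"
  proof
    fix l assume "l \<in> {l. digit b m l \<noteq> 0}"
    then have "\<not> m \<le> l" using digit_eq_0[OF assms, of m l] by auto
    then show "l \<in> {..<m}" by simp
  qed
qed simp

lemma finite_bbinom_support:
  assumes "2 \<le> b"
  shows "finite {l. (digit b n l choose digit b k l) \<noteq> 1}"
proof (rule finite_subset)
  show "{l. (digit b n l choose digit b k l) \<noteq> 1} \<subseteq> {l. digit b k l \<noteq> 0}"
    by (metis (mono_tags, lifting) binomial_n_0 mem_Collect_eq subsetI)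
qed (rule finite_digit_support[OF assms])

text \<open>The next three facts identify \<^const>\<open>digit\<close> with the base-\<open>b\<close> digits, i.e. the unique
  finitely supported coefficients below \<open>b\<close> in the expansion of \<open>m\<close> in powers of \<open>b\<close>.\<close>

lemma digit_less:
  assumes "2 \<le> b"
  shows "digit b m l < b"
  using assms by (simp add: digit_def)

lemma digit_expansion:
  assumes "2 \<le> b"
  shows "Sum_any (\<lambda>l. digit b m l * b ^ l) = m"
proof -
  have partial: "(\<Sum>l<N. digit b m l * b ^ l) = m mod b ^ N" for N
  proof (induction N)
    case (Suc N)
    have "m mod b ^ Suc N = m mod (b ^ N * b)" by (simp only: power_Suc2)
    also have "\<dots> = b ^ N * digit b m N + m mod b ^ N"
      by (simp only: mod_mult2_eq digit_def)
    finally show ?case using Suc by (simp add: mult.commute)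
  qed simp
  have "m < 2 ^ m" by (rule less_exp)
  also have "(2::nat) ^ m \<le> b ^ m" using assms by (rule power_mono) simp
  finally have mod: "m mod b ^ m = m" by simp
  have zero: "l < m" if "digit b m l \<noteq> 0" for l
    using digit_eq_0[OF assms, of m l] that by (meson leI)
  have "Sum_any (\<lambda>l. digit b m l * b ^ l) = (\<Sum>l<m. digit b m l * b ^ l)"
    by (rule Sum_any.expand_superset)
      (use zero in auto)
  then show ?thesis using partial mod by simp
qed

lemma digit_unique:
  fixes d :: "nat \<Rightarrow> nat"
  assumes "2 \<le> b" and "finite {l. d l \<noteq> 0}" and "\<And>l. d l < b"
    and "Sum_any (\<lambda>l. d l * b ^ l) = m"
  shows "d l = digit b m l"
proof -
  have partial: "digit b (\<Sum>l<N. d l * b ^ l) i = d i"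
    if "i < N" "\<And>l. d l < b" for N i and d :: "nat \<Rightarrow> nat"
    using that
  proof (induction N arbitrary: i d)
    case 0
    then show ?case by simp
  next
    case (Suc N)
    have split: "(\<Sum>l<Suc N. d l * b ^ l) = d 0 + b * (\<Sum>l<N. d (Suc l) * b ^ l)"
      by (simp add: sum.lessThan_Suc_shift sum_distrib_left mult_ac del: sum.lessThan_Suc)
    show ?case
    proof (cases i)
      case 0
      then show ?thesis using Suc.prems by (simp add: split digit_def del: sum.lessThan_Suc)
    next
      case (Suc i')
      have "digit b (\<Sum>l<N. d (Suc l) * b ^ l) i' = d (Suc i')"
        using Suc.IH[of i' "\<lambda>l. d (Suc l)"] Suc.prems Suc by simp
      moreover have "(d 0 + b * s) div b = s" for s
        using Suc.prems(2)[of 0] assms(1) by simp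
      ultimately show ?thesis
        by (simp add: split digit_def Suc div_mult2_eq del: sum.lessThan_Suc)
    qed
  qed
  obtain N0 where N0: "{l. d l \<noteq> 0} \<subseteq> {..<N0}"
    using assms(2) unfolding finite_nat_set_iff_bounded by blast
  define N where "N = max N0 (Suc l)"
  have "Sum_any (\<lambda>l. d l * b ^ l) = (\<Sum>l<N. d l * b ^ l)"
    by (rule Sum_any.expand_superset) (use N0 in \<open>auto simp: N_def\<close>)
  then show ?thesis
    using partial[of l N d] assms(3,4) by (simp add: N_def)
qed

end

theory Submission
  imports Defs
begin

text \<open>Writing \<open>n = n\<^sub>0 + b n'\<close> with \<open>n\<^sub>0 < b\<close>, and likewise for \<open>k\<close> and \<open>j\<close>, every summand factors into
  a lowest-digit part and a summand for \<open>n'\<close>, \<open>k'\<close>, \<open>j'\<close>. As \<open>k\<close> runs through complete blocks of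
  length \<open>b\<close>, the sum is a product of the classical alternating binomial sum for \<open>n\<^sub>0\<close>, \<open>j\<^sub>0\<close> and the
  sum for \<open>n'\<close>, \<open>j'\<close>, so induction on \<open>n\<close> applies.\<close>

text \<open>Trinomial revision (\<open>choose_mult\<close>) pulls the constant
  \<open>n choose j\<close> out of the sum. What remains is the alternating sum over row
  \<open>n - j\<close> of Pascal's triangle, which vanishes unless \<open>n = j\<close>. For
  \<open>j > n\<close> every summand is zero.\<close>

lemma sum_binomial_binomial_alternating:
  "(\<Sum>r\<le>n. int (n choose r) * int (r choose j) * (- 1) ^ (r + j)) = (if n = j then 1 else 0)"
proof (cases "j \<le> n")
  case True
  have "(\<Sum>r\<le>n. int (n choose r) * int (r choose j) * (- 1) ^ (r + j))
      = (\<Sum>r=j..n. int (n choose r) * int (r choose j) * (- 1) ^ (r + j))"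
    by (rule sum.mono_neutral_right) auto
  \<comment> \<open>Both bounds are put in the form \<open>_ + j\<close> so that the index shift
    \<open>r = i + j\<close> matches.\<close>
  also have "\<dots> = (\<Sum>r=0+j..(n-j)+j. int (n choose r) * int (r choose j) * (- 1) ^ (r + j))"
    using True by simp
  also have "\<dots> = (\<Sum>i=0..n-j. int (n choose (i+j)) * int ((i+j) choose j) * (- 1) ^ (i + j + j))"
    by (rule sum.shift_bounds_cl_nat_ivl)
  also have "\<dots> = (\<Sum>i\<le>n-j. int (n choose j) * ((- 1) ^ i * int ((n-j) choose i)))"
  proof (rule sum.cong)
    fix i assume "i \<in> {..n-j}"
    then have "(n choose (i+j)) * ((i+j) choose j) = (n choose j) * ((n-j) choose i)"
      using True choose_mult[of j "i+j" n] by simp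
    then have "int (n choose (i+j)) * int ((i+j) choose j) = int (n choose j) * int ((n-j) choose i)"
      by (metis of_nat_mult)
    \<comment> \<open>The two factors \<open>(- 1) ^ j\<close> cancel, which leaves the sign
      \<open>(- 1) ^ i\<close>.\<close>
    then show "int (n choose (i+j)) * int ((i+j) choose j) * (- 1) ^ (i + j + j)
        = int (n choose j) * ((- 1) ^ i * int ((n-j) choose i))"
      by (simp add: power_add mult.assoc flip: power_mult_distrib)
  qed auto
  also have "\<dots> = int (n choose j) * (\<Sum>i\<le>n-j. (- 1) ^ i * int ((n-j) choose i))"
    by (simp add: sum_distrib_left)
  also have "\<dots> = (if n = j then 1 else 0)"
    using True choose_alternating_sum[of "n-j", where 'a=int] by auto
  finally show ?thesis .
qed (auto intro!: sum.neutral)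

lemma digit_0 [simp]: "digit b m 0 = m mod b"
  by (simp add: digit_def)

lemma digit_Suc: "digit b m (Suc l) = digit b (m div b) l"
  by (simp add: digit_def div_mult2_eq)

text \<open>With infinite support both occurrences of \<open>Sum_any\<close> would default to 0 and
  the term \<open>f 0\<close> would be lost.\<close>

lemma Sum_any_Suc_shift:
  fixes f :: "nat \<Rightarrow> 'a::comm_monoid_add"
  assumes "finite {l. f l \<noteq> 0}"
  shows "Sum_any f = f 0 + Sum_any (\<lambda>l. f (Suc l))"
proof -
  obtain N where N: "{l. f l \<noteq> 0} \<subseteq> {..<N}"
    using assms unfolding finite_nat_set_iff_bounded by blast
  have "Sum_any f = sum f {..<Suc N}"
    by (rule Sum_any.expand_superset) (use N in auto)
  also have "\<dots> = f 0 + (\<Sum>l<N. f (Suc l))"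
    by (rule sum.lessThan_Suc_shift)
  also have "(\<Sum>l<N. f (Suc l)) = Sum_any (\<lambda>l. f (Suc l))"
    by (rule Sum_any.expand_superset[symmetric]) (use N in auto)
  finally show ?thesis .
qed

lemma Prod_any_Suc_shift:
  fixes f :: "nat \<Rightarrow> 'a::comm_monoid_mult"
  assumes "finite {l. f l \<noteq> 1}"
  shows "Prod_any f = f 0 * Prod_any (\<lambda>l. f (Suc l))"
proof -
  obtain N where N: "{l. f l \<noteq> 1} \<subseteq> {..<N}"
    using assms unfolding finite_nat_set_iff_bounded by blast
  have "Prod_any f = prod f {..<Suc N}"
    by (rule Prod_any.expand_superset) (use N in auto)
  also have "\<dots> = f 0 * (\<Prod>l<N. f (Suc l))"
    by (rule prod.lessThan_Suc_shift)
  also have "(\<Prod>l<N. f (Suc l)) = Prod_any (\<lambda>l. f (Suc l))"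
    by (rule Prod_any.expand_superset[symmetric]) (use N in auto)
  finally show ?thesis .
qed

lemma digit_sum_rec:
  assumes "2 \<le> b"
  shows "digit_sum b m = m mod b + digit_sum b (m div b)"
  unfolding digit_sum_def
  by (subst Sum_any_Suc_shift[OF finite_digit_support[OF assms]]) (simp add: digit_Suc)

lemma bbinom_rec:
  assumes "2 \<le> b"
  shows "bbinom b n k = (n mod b choose (k mod b)) * bbinom b (n div b) (k div b)"
  unfolding bbinom_def
  by (subst Prod_any_Suc_shift[OF finite_bbinom_support[OF assms]]) (simp add: digit_Suc)

lemma bbinom_0_right [simp]: "bbinom b n 0 = 1"
  by (simp add: bbinom_def digit_def del: One_nat_def)

text \<open>At the highest position where the digits of \<open>n\<close> and \<open>k\<close>
  differ, \<open>k\<close> has the larger digit, so that factor is zero. The induction strips lowest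
  digits until the quotients by \<open>b\<close> agree; then the lowest digits decide.\<close>

lemma bbinom_eq_0:
  assumes "2 \<le> b" "n < k"
  shows "bbinom b n k = 0"
  using assms(2)
proof (induction k arbitrary: n rule: less_induct)
  case (less k)
  show ?case
  proof (cases "n div b < k div b")
    case True
    moreover have "k div b < k"
      using assms(1) less.prems by simp
    ultimately show ?thesis
      using less.IH by (simp add: bbinom_rec[OF assms(1), of n k])
  next
    case False
    then have "n div b = k div b"
      using less.prems by (simp add: div_le_mono le_antisym)
    then have "n mod b < k mod b"
      using less.prems by (metis div_mult_mod_eq nat_add_left_cancel_less)
    then show ?thesis
      by (simp add: bbinom_rec[OF assms(1), of n k])
  qed
qed

text \<open>The range starts at 0 instead of \<open>j\<close> so that it can be extended to complete
  blocks of length \<open>b\<close>. The index \<open>j\<close> is generalized because the induction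
  hypothesis is applied to \<open>j div b\<close>.\<close>

lemma sum_bbinom_bbinom_alternating:
  assumes "2 \<le> b"
  shows "(\<Sum>k\<le>n. int (bbinom b n k) * int (bbinom b k j) * (- 1) ^ (digit_sum b k + digit_sum b j))
    = (if n = j then 1 else 0)"
proof (induction n arbitrary: j rule: less_induct)
  case (less n)
  define t where "t n j k = int (bbinom b n k) * int (bbinom b k j)
    * (- 1) ^ (digit_sum b k + digit_sum b j)" for n j k
  define u where "u n j r = int (n choose r) * int (r choose j) * (- 1) ^ (r + j)" for n j r :: nat
  show ?case
  proof (cases "n = 0")
    case True
    \<comment> \<open>Only \<open>k = 0\<close> occurs. If \<open>j = 0\<close>, the exponent is
      twice \<open>digit_sum b 0\<close>, hence even.\<close>
    then show ?thesis
      using bbinom_eq_0[OF assms, of 0 j] by (cases "j = 0") (auto simp flip: mult_2)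
  next
    case False
    have b: "0 < b" using assms by simp
    have t_rec: "t n j (q * b + r) = u (n mod b) (j mod b) r * t (n div b) (j div b) q"
      if "r < b" for q r
      using that by (simp add: t_def u_def bbinom_rec[OF assms, of n] bbinom_rec[OF assms, of _ j]
          digit_sum_rec[OF assms, of "q * b + r"] digit_sum_rec[OF assms, of j] power_add)
    \<comment> \<open>The range is padded to the end of the block containing \<open>n\<close>; the
      new terms have \<open>k > n\<close> and vanish by \<open>bbinom_eq_0\<close>.\<close>
    have "(\<Sum>k\<le>n. t n j k) = (\<Sum>k<Suc (n div b) * b. t n j k)"
    proof (rule sum.mono_neutral_left)
      have "n < Suc (n div b) * b"
        using dividend_less_times_div[OF b, of n] by (simp add: algebra_simps)
      then show "{..n} \<subseteq> {..<Suc (n div b) * b}" by auto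
    qed (use bbinom_eq_0[OF assms] in \<open>auto simp: t_def\<close>)
    also have "\<dots> = (\<Sum>q<Suc (n div b). \<Sum>k=q*b..<q*b+b. t n j k)"
      by (rule sum.nat_group[symmetric])
    also have "\<dots> = (\<Sum>q<Suc (n div b). \<Sum>r<b. t n j (q * b + r))"
      using sum.shift_bounds_nat_ivl[of "t n j" 0 "_ * b" b]
      by (simp add: lessThan_atLeast0 add.commute)
    also have "\<dots> = (\<Sum>q\<le>n div b. \<Sum>r<b. u (n mod b) (j mod b) r * t (n div b) (j div b) q)"
      unfolding lessThan_Suc_atMost by (intro sum.cong refl t_rec) simp
    also have "\<dots> = (\<Sum>r<b. u (n mod b) (j mod b) r) * (\<Sum>q\<le>n div b. t (n div b) (j div b) q)"
      by (simp add: sum_product sum.swap[of _ "{..<b}"])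
    also have "(\<Sum>q\<le>n div b. t (n div b) (j div b) q) = (if n div b = j div b then 1 else 0)"
      using less.IH[of "n div b" "j div b"] False assms by (simp add: t_def)
    \<comment> \<open>Digits \<open>r\<close> above \<open>n mod b\<close> contribute a zero
      binomial, so the full block reduces to the range of the classical identity.\<close>
    also have "(\<Sum>r<b. u (n mod b) (j mod b) r) = (\<Sum>r\<le>n mod b. u (n mod b) (j mod b) r)"
      by (rule sum.mono_neutral_right)
        (use mod_less_divisor[OF b, of n] in \<open>auto simp: u_def intro: le_less_trans\<close>)
    also have "\<dots> = (if n mod b = j mod b then 1 else 0)"
      unfolding u_def by (rule sum_binomial_binomial_alternating)
    also have "\<dots> * (if n div b = j div b then 1 else 0) = (if n = j then 1 else (0::int))"
      by (auto, metis div_mult_mod_eq)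
    finally show ?thesis by (simp add: t_def)
  qed
qed

theorem theorem4p7:
  fixes b n j :: nat
  assumes "b \<ge> 2" and "j \<le> n"
  shows "(\<Sum>k=j..n. int (bbinom b n k) * int (bbinom b k j)
            * (- 1) ^ (digit_sum b k + digit_sum b j))
         = (if n = j then 1 else 0)"
proof -
  have "(\<Sum>k=j..n. int (bbinom b n k) * int (bbinom b k j) * (- 1) ^ (digit_sum b k + digit_sum b j))
      = (\<Sum>k\<le>n. int (bbinom b n k) * int (bbinom b k j) * (- 1) ^ (digit_sum b k + digit_sum b j))"
    \<comment> \<open>The additional terms have \<open>k < j\<close>, so \<open>bbinom b k j\<close>
      is zero.\<close>
    by (rule sum.mono_neutral_left) (use bbinom_eq_0[OF assms(1)] in auto)
  then show ?thesis
    using sum_bbinom_bbinom_alternating[OF assms(1)] by simp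
qed

end
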